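(* Let $S$ be a nonempty (possibly infinite) set of positive integers and let $k\ge 0$ be an integer. As formal power series in $z$ over $\mathbb{Q}$, $$\sum_{n=0}^\infty \begin{bmatrix}n \\k \end{bmatrix}_S \frac{z^n}{n!} = \mathrm{SET}_{k} \left( \sum_{s \in S}\mathrm{CYC}_{s}(\mathcal{Z}) \right)= \frac{1}{k!} \left(\sum_{s \in S} \frac{z^{s}}{s} \right)^k,$$ $$\sum_{n=0}^\infty \begin{Bmatrix}n \\k \end{Bmatrix}_S \frac{z^n}{n!} = \mathrm{SET}_{k} \left( \sum_{s \in S}\mathrm{SET}_{s}(\mathcal{Z}) \right)= \frac{1}{k!} \left(\sum_{s \in S} \frac{z^{s}}{s!} \right)^k,$$ $$\sum_{n=0}^\infty A_{n,S}\frac{z^n}{n!} = \mathrm{SET}\left( \sum_{s\in S} \mathrm{CYC}_{s}(\mathcal{Z}) \right) =\exp \left(\sum_{s \in S} \frac{z^{s}}{s} \right),$$ $$\sum_{n=0}^\infty B_{n,S}\frac{z^n}{n!} = \mathrm{SET}\left( \sum_{s\in S} \mathrm{SET}_{s}(\mathcal{Z}) \right)=\exp \left(\sum_{s \in S} \frac{z^{s}}{s!} \right).$$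
   Context: For a set $S$ of positive integers and integers $n,k\ge 0$: - $\begin{bmatrix}n\\k\end{bmatrix}_S$ is the number of permutations of $n$ labeled elements having exactly $k$ cycles, each cycle having a length (number of elements, fixed points being cycles of length 1) belonging to $S$. - $\begin{Bmatrix}n\\k\end{Bmatrix}_S$ is the number of set partitions of an $n$-element set into exactly $k$ (nonempty, unlabeled) blocks, each block having size belonging to $S$. - $A_{n,S}$ is the number of permutations of $n$ labeled elements all of whose cycle lengths belong to $S$; $B_{n,S}$ is the number of set partitions of an $n$-element set all of whose block sizes belong to $S$. Thus $A_{n,S}=\sum_{k=0}^n \begin{bmatrix}n\\k\end{bmatrix}_S$ and $B_{n,S}=\sum_{k=0}^n \begin{Bmatrix}n\\k\end{Bmatrix}_S$. Initial values: $\begin{bmatrix}0\\0\end{bmatrix}_S=\begin{Bmatrix}0\\0\end{Bmatrix}_S=1$, $A_{0,S}=B_{0,S}=1$; for $n\ge1$, $k\ge 1$, $\begin{bmatrix}n\\0\end{bmatrix}_S=\begin{Bmatrix}n\\0\end{Bmatrix}_S=\begin{bmatrix}0\\k\end{bmatrix}_S=\begin{Bmatrix}0\\k\end{Bmatrix}_S=0$. Symbolic constructions on labeled classes are identified with their exponential generating functions: $\mathcal{Z}$ is the atomic class of a single element of size one, with generating function $z$. If a labeled class $\mathcal{B}$ has exponential generating function $B(z)$ with zero constant term, then $\mathrm{SET}(\mathcal{B})$ (finite sets of elements of $\mathcal{B}$, relabeled) has generating function $\exp(B(z))$, $\mathrm{SET}_k(\mathcal{B})$ ($k$-element sets) has generating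 function $B(z)^k/k!$, and $\mathrm{CYC}_k(\mathcal{B})$ ($k$-element sequences modulo cyclic permutation, $k\ge1$) has generating function $B(z)^k/k$. Sums of classes (disjoint unions) correspond to sums of generating functions. *)

theory Defs
  imports
    "HOL-Analysis.Infinite_Sum"
    "HOL-Computational_Algebra.Formal_Power_Series"
    "HOL-Combinatorics.Orbits"
    "HOL-Library.Disjoint_Sets"
begin

section \<open>Permutations and set partitions with restricted cycle and block sizes\<close>

text \<open>For a permutation of \<open>A\<close>, the orbits of the points of \<open>A\<close> are the supports of its cycles;
  a fixed point contributes a singleton orbit.\<close>

definition perm_cycles :: "('a \<Rightarrow> 'a) \<Rightarrow> 'a set \<Rightarrow> 'a set set" where
  "perm_cycles p A = orbit p ` A"

definition perms_S :: "nat set \<Rightarrow> nat \<Rightarrow> (nat \<Rightarrow> nat) set" where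
  "perms_S S n = {p. p permutes {..<n} \<and> (\<forall>c\<in>perm_cycles p {..<n}. card c \<in> S)}"

definition parts_S :: "nat set \<Rightarrow> nat \<Rightarrow> nat set set set" where
  "parts_S S n = {P. partition_on {..<n} P \<and> (\<forall>b\<in>P. card b \<in> S)}"

definition stirling1_S :: "nat set \<Rightarrow> nat \<Rightarrow> nat \<Rightarrow> nat" where
  "stirling1_S S n k = card {p \<in> perms_S S n. card (perm_cycles p {..<n}) = k}"

definition stirling2_S :: "nat set \<Rightarrow> nat \<Rightarrow> nat \<Rightarrow> nat" where
  "stirling2_S S n k = card {P \<in> parts_S S n. card P = k}"

definition A_S :: "nat set \<Rightarrow> nat \<Rightarrow> nat" where
  "A_S S n = card (perms_S S n)"

definition B_S :: "nat set \<Rightarrow> nat \<Rightarrow> nat" where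
  "B_S S n = card (parts_S S n)"


section \<open>Generating functions and symbolic constructions\<close>

definition egf :: "(nat \<Rightarrow> nat) \<Rightarrow> rat fps" where
  "egf a = Abs_fps (\<lambda>n. of_nat (a n) / fact n)"

text \<open>Labeled classes are identified with their exponential generating functions, so the
  constructions below are operators on power series. They are meant for arguments with zero
  constant term, and \<open>CYC\<close> for an index \<open>k \<ge> 1\<close>. The sum of a possibly infinite family of classes
  is \<^const>\<open>infsum\<close> with respect to the usual (coefficientwise discrete) topology on \<open>rat fps\<close>.\<close>

definition atom :: "rat fps" where
  "atom = fps_X"

definition SET :: "rat fps \<Rightarrow> rat fps" where
  "SET F = fps_exp 1 oo F"

definition SETk :: "nat \<Rightarrow> rat fps \<Rightarrow> rat fps" where
  "SETk k F = fps_const (1 / fact k) * F ^ k"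

definition CYCk :: "nat \<Rightarrow> rat fps \<Rightarrow> rat fps" where
  "CYCk k F = fps_const (1 / of_nat k) * F ^ k"

text \<open>Every family of monomials with distinct exponents is summable, so \<^const>\<open>infsum\<close> never takes
  its default value in the sums over \<open>S\<close> of such families.\<close>

lemma has_sum_fps_monomials:
  fixes c :: "nat \<Rightarrow> rat"
  shows "((\<lambda>s. fps_const (c s) * fps_X ^ s) has_sum Abs_fps (\<lambda>n. if n \<in> S then c n else 0)) S"
  unfolding has_sum_def
proof (rule tendsto_fpsI)
  fix n
  show "\<forall>\<^sub>F F in finite_subsets_at_top S.
      fps_nth (\<Sum>s\<in>F. fps_const (c s) * fps_X ^ s) n
        = fps_nth (Abs_fps (\<lambda>n. if n \<in> S then c n else 0)) n"
    unfolding eventually_finite_subsets_at_top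
  proof (intro exI[of _ "S \<inter> {n}"] conjI allI impI)
    fix F assume F: "finite F \<and> S \<inter> {n} \<subseteq> F \<and> F \<subseteq> S"
    have "fps_nth (\<Sum>s\<in>F. fps_const (c s) * fps_X ^ s) n = (\<Sum>s\<in>F. if n = s then c s else 0)"
      by (simp add: fps_sum_nth fps_X_power_nth if_distrib cong: if_cong)
    also have "\<dots> = (if n \<in> S then c n else 0)"
      using F by (auto simp: sum.delta')
    finally show "fps_nth (\<Sum>s\<in>F. fps_const (c s) * fps_X ^ s) n
        = fps_nth (Abs_fps (\<lambda>n. if n \<in> S then c n else 0)) n" by simp
  qed auto
qed

end

theory Submission
  imports Defs
begin

section \<open>The exponential formula from a block recurrence\<close>

text \<open>Grouping subsets by size produces the binomial weights. This turns a sum over candidate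
  blocks into a sum over block sizes.\<close>

lemma sum_Pow_card:
  fixes g :: "nat \<Rightarrow> 'b::comm_semiring_1"
  assumes "finite A"
  shows "(\<Sum>B\<in>Pow A. g (card B)) = (\<Sum>j\<le>card A. of_nat (card A choose j) * g j)"
proof -
  have "(\<Sum>B\<in>Pow A. g (card B)) = (\<Sum>j\<le>card A. \<Sum>B\<in>{B\<in>Pow A. card B = j}. g (card B))"
    using assms by (intro sum.group [symmetric]) (auto intro: card_mono)
  also have "\<dots> = (\<Sum>j\<le>card A. of_nat (card A choose j) * g j)"
    using n_subsets[OF assms] by (intro sum.cong) auto
  finally show ?thesis .
qed

text \<open>Differentiating brings down the factor \<open>k + 1\<close>, which reduces
  \<open>1 / (k + 1)!\<close> to \<open>1 / k!\<close>. Combinatorially, marking a point in a set of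
  \<open>k + 1\<close> components singles out the component that contains it.\<close>

lemma fps_deriv_SETk_Suc: "fps_deriv (SETk (Suc k) F) = fps_deriv F * SETk k F"
proof -
  have "fps_const (1 / fact (Suc k)) * fps_const (of_nat (Suc k)) = (fps_const (1 / fact k) :: rat fps)"
    unfolding fps_const_mult by (simp add: field_simps del: of_nat_Suc)
  moreover have "fps_deriv (SETk (Suc k) F)
      = (fps_const (1 / fact (Suc k)) * fps_const (of_nat (Suc k))) * fps_deriv F * F ^ k"
    unfolding SETk_def fps_deriv_mult fps_deriv_const fps_deriv_power diff_Suc_1
    by (simp only: mult_zero_left add_0_left add_0_right mult.assoc)
  ultimately show ?thesis by (simp only: SETk_def mult.assoc mult.left_commute)
qed

lemma egf_nth: "fps_nth (egf a) n = of_nat (a n) / fact n"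
  by (simp add: egf_def)

text \<open>Coefficient form of the derivative rule: \<open>w (Suc j) / fact j\<close> is the
  coefficient of \<open>fps_deriv (egf w)\<close> in degree \<open>j\<close>, with \<open>j\<close>
  counting the unmarked points of the marked component.\<close>

lemma SETk_egf_Suc_nth:
  "of_nat (Suc n) * fps_nth (SETk (Suc k) (egf w)) (Suc n)
    = (\<Sum>j\<le>n. of_nat (w (Suc j)) / fact j * fps_nth (SETk k (egf w)) (n - j))"
proof -
  have "of_nat (Suc n) * fps_nth (SETk (Suc k) (egf w)) (Suc n)
      = fps_nth (fps_deriv (egf w) * SETk k (egf w)) n"
    unfolding fps_deriv_SETk_Suc [symmetric] by simp
  also have "\<dots> = (\<Sum>j\<le>n. of_nat (w (Suc j)) / fact j * fps_nth (SETk k (egf w)) (n - j))"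
    by (simp add: fps_mult_nth egf_nth atLeast0AtMost del: of_nat_Suc)
  finally show ?thesis .
qed

text \<open>Here \<open>B\<close> is the block of \<open>a\<close> with \<open>a\<close> removed, so the recurrence is the coefficientwise form
  of \<open>(F ^ (k + 1) / (k + 1)!)' = F' * (F ^ k / k!)\<close> for \<open>F = egf w\<close>. Since it determines \<open>f\<close> on all finite sets, invariance of \<open>f\<close> under relabelling need not be assumed.\<close>

lemma block_recurrence_egf:
  fixes f :: "'a set \<Rightarrow> nat \<Rightarrow> nat" and w :: "nat \<Rightarrow> nat"
  assumes w0: "w 0 = 0"
    and empty: "\<And>k. f {} k = (if k = 0 then 1 else 0)"
    and zero: "\<And>A a. finite A \<Longrightarrow> a \<notin> A \<Longrightarrow> f (insert a A) 0 = 0"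
    and Suc: "\<And>A a k. finite A \<Longrightarrow> a \<notin> A \<Longrightarrow>
      f (insert a A) (Suc k) = (\<Sum>B\<in>Pow A. w (Suc (card B)) * f (A - B) k)"
    and "finite A"
  shows "of_nat (f A k) / fact (card A) = fps_nth (SETk k (egf w)) (card A)"
  using \<open>finite A\<close>
proof (induction k arbitrary: A)
  case 0
  show ?case
  proof (cases "A = {}")
    case False
    then obtain a B where "A = insert a B" "a \<notin> B"
      by (meson Set.set_insert ex_in_conv)
    with 0 show ?thesis using zero[of B a] by (simp add: SETk_def)
  qed (simp add: empty SETk_def)
next
  case (Suc k)
  let ?G = "\<lambda>k. fps_nth (SETk k (egf w))"
  show ?case
  proof (cases "A = {}")
    case True
    \<comment> \<open>\<open>w 0 = 0\<close> kills the constant term of \<open>egf w\<close>, hence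
      that of every positive power.\<close>
    then show ?thesis by (simp add: empty SETk_def egf_nth w0)
  next
    case False
    then obtain a B where A: "A = insert a B" "a \<notin> B"
      by (meson Set.set_insert ex_in_conv)
    then have fin: "finite B" using Suc.prems by simp
    define n where "n = card B"
    have IH: "of_nat (f (B - C) k) = fact (n - card C) * ?G k (n - card C)" if "C \<subseteq> B" for C
      using Suc.IH[of "B - C"] fin that finite_subset[OF that fin]
      by (simp add: n_def card_Diff_subset field_simps)
    have "(of_nat (f A (Suc k)) :: rat)
        = (\<Sum>C\<in>Pow B. of_nat (w (Suc (card C))) * (fact (n - card C) * ?G k (n - card C)))"
      unfolding A(1) assms(4)[OF fin A(2)] of_nat_sum of_nat_mult
      by (intro sum.cong) (auto simp: IH)
    also have "\<dots> = (\<Sum>j\<le>n. of_nat (n choose j) * (of_nat (w (Suc j)) * (fact (n - j) * ?G k (n - j))))"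
      unfolding n_def by (rule sum_Pow_card[OF fin])
    \<comment> \<open>\<open>(n choose j) * (n - j)!\<close> equals \<open>n! / j!\<close>, so the
      binomial sum becomes a Cauchy product.\<close>
    also have "\<dots> = fact n * (\<Sum>j\<le>n. of_nat (w (Suc j)) / fact j * ?G k (n - j))"
      unfolding sum_distrib_left by (intro sum.cong) (auto simp: binomial_fact)
    also have "\<dots> = fact (Suc n) * ?G (Suc k) (Suc n)"
      unfolding SETk_egf_Suc_nth [symmetric] by (simp add: algebra_simps)
    finally show ?thesis
      using A fin by (simp add: n_def del: fact_Suc)
  qed
qed

text \<open>The exponential series weights \<open>F ^ k\<close> by \<open>1 / k!\<close>. With zero
  constant term, \<open>F ^ k\<close> starts no earlier than degree \<open>k\<close>, so only
  \<open>k \<le> n\<close> matters.\<close>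

lemma SET_nth:
  assumes "fps_nth F 0 = 0"
  shows "fps_nth (SET F) n = (\<Sum>k\<le>n. fps_nth (SETk k F) n)"
  by (simp add: SET_def SETk_def fps_compose_nth atLeast0AtMost)


section \<open>Set partitions\<close>

text \<open>Arbitrary ground sets replace \<open>{..<n}\<close>, because removing the block of a
  point generally leaves no initial segment.\<close>

definition part_count :: "nat set \<Rightarrow> 'a set \<Rightarrow> nat \<Rightarrow> nat" where
  "part_count S A k = card {P. partition_on A P \<and> (\<forall>b\<in>P. card b \<in> S) \<and> card P = k}"

section \<open>Splitting a partition at the block of a point\<close>

lemma bij_betw_Collect_card:
  assumes "bij_betw f T X"
  shows "card {x \<in> X. Q x} = card {t \<in> T. Q (f t)}"
proof -
  have "f ` {t \<in> T. Q (f t)} = {x \<in> X. Q x}" "inj_on f {t \<in> T. Q (f t)}"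
    using assms by (auto simp: bij_betw_def intro: inj_on_subset)
  then show ?thesis using card_image by metis
qed

text \<open>The point \<open>a\<close> distinguishes exactly one block, so nothing is counted twice;
  the inverse reads off that block and removes it from the partition.\<close>

lemma bij_betw_partition_insert:
  assumes "a \<notin> A"
  shows "bij_betw (\<lambda>(B, P). insert (insert a B) P)
    (SIGMA B:Pow A. {P. partition_on (A - B) P}) {P. partition_on (insert a A) P}"
    (is "bij_betw ?f ?T ?X")
proof -
  define block where "block = (\<lambda>P. THE b. b \<in> P \<and> a \<in> b)"
  define g where "g = (\<lambda>P. (block P - {a}, P - {block P}))"
  \<comment> \<open>The members of \<open>P\<close> lie inside \<open>A - B\<close> and miss
    \<open>a\<close>, so the new block is the only one through \<open>a\<close>.\<close>
  have *: "block (insert (insert a B) P) = insert a B" "insert a B \<notin> P" "a \<notin> B"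
    if "B \<subseteq> A" "partition_on (A - B) P" for B P
    using assms that by (auto simp: block_def partition_on_def intro!: the_equality)
  have **: "block P \<in> P" "a \<in> block P" if P: "partition_on (insert a A) P" for P
  proof -
    obtain b where b: "b \<in> P" "a \<in> b"
      using partition_onD1[OF P] by blast
    \<comment> \<open>Disjointness of the blocks makes the description in \<open>block\<close>
      unique.\<close>
    have uniq: "c = b" if "c \<in> P \<and> a \<in> c" for c
      using that b P by (auto simp: partition_on_def disjoint_def)
    have "block P = b"
      unfolding block_def
    proof (rule the_equality)
      show "b \<in> P \<and> a \<in> b" using b by simp
    qed (fact uniq)
    then show "block P \<in> P" "a \<in> block P" using b by simp_all
  qed
  show ?thesis
  proof (rule bij_betw_byWitness[where f' = g])
    show "\<forall>t\<in>?T. g (?f t) = t"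
      using * by (auto simp: g_def)
    show "\<forall>P\<in>?X. ?f (g P) = P"
      using ** by (simp add: g_def insert_absorb)
    show "?f ` ?T \<subseteq> ?X"
    proof clarify
      fix B P assume B: "B \<subseteq> A" "partition_on (A - B) P"
      have "disjnt (insert a B) (\<Union>P)" "insert a A - insert a B = A - B"
        using partition_onD1[OF B(2)] B(1) assms by (auto simp: disjnt_def)
      then show "partition_on (insert a A) (insert (insert a B) P)"
        using partition_on_insert[of "insert a B" P "insert a A"] B by auto
    qed
    show "g ` ?X \<subseteq> ?T"
    proof (rule image_subsetI)
      fix P assume "P \<in> ?X"
      then have P: "partition_on (insert a A) P" by simp
      let ?b = "block P"
      have b: "?b \<in> P" "a \<in> ?b" using **[OF P] by auto
      then have "?b \<subseteq> insert a A" using P by (auto simp: partition_on_def)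
      moreover have "disjnt ?b (\<Union>(P - {?b}))"
        using P b(1) by (auto simp: partition_on_def disjoint_def disjnt_def)
      then have "partition_on (insert a A - ?b) (P - {?b})"
        using partition_on_insert[of ?b "P - {?b}" "insert a A"] P b(1) by (simp add: insert_absorb)
      moreover have "insert a A - ?b = A - (?b - {a})" using b(2) assms by blast
      ultimately show "g P \<in> ?T" by (auto simp: g_def)
    qed
  qed
qed

text \<open>The size condition separates into one on the block of \<open>a\<close>, which has
  \<open>card B + 1\<close> points, and one on the remaining blocks. The weight is an indicator, as
  a point set carries only one block structure.\<close>

lemma part_count_insert:
  assumes "finite A" "a \<notin> A"
  shows "part_count S (insert a A) (Suc k)
    = (\<Sum>B\<in>Pow A. (if Suc (card B) \<in> S then 1 else 0) * part_count S (A - B) k)"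
proof -
  let ?Q = "\<lambda>P. (\<forall>b\<in>P. card b \<in> S) \<and> card P = Suc k"
  let ?N = "\<lambda>B. {P. partition_on (A - B) P \<and> (\<forall>b\<in>P. card b \<in> S) \<and> card P = k}"
  have "part_count S (insert a A) (Suc k) = card {P \<in> {P. partition_on (insert a A) P}. ?Q P}"
    by (simp add: part_count_def)
  also have "\<dots> = card {t \<in> (SIGMA B:Pow A. {P. partition_on (A - B) P}).
      ?Q ((\<lambda>(B, P). insert (insert a B) P) t)}"
    by (rule bij_betw_Collect_card[OF bij_betw_partition_insert[OF assms(2)]])
  also have "{t \<in> (SIGMA B:Pow A. {P. partition_on (A - B) P}).
      ?Q ((\<lambda>(B, P). insert (insert a B) P) t)} = (SIGMA B:{B \<in> Pow A. Suc (card B) \<in> S}. ?N B)"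
  proof -
    have "finite P" "insert a B \<notin> P" "card (insert a B) = Suc (card B)"
      if "B \<subseteq> A" "partition_on (A - B) P" for B P
    proof -
      show "finite P" using finite_elements[OF _ that(2)] assms(1) by simp
      show "insert a B \<notin> P" using partition_onD1[OF that(2)] assms(2) by blast
      show "card (insert a B) = Suc (card B)"
        using that(1) assms finite_subset by (intro card_insert_disjoint) auto
    qed
    then show ?thesis by (auto; metis card_insert_disjoint nat.inject)
  qed
  also have "card \<dots> = (\<Sum>B\<in>{B \<in> Pow A. Suc (card B) \<in> S}. part_count S (A - B) k)"
  proof (subst card_SigmaI)
    show "\<forall>B\<in>{B \<in> Pow A. Suc (card B) \<in> S}. finite (?N B)"
      using assms(1) finitely_many_partition_on[of "A - B" for B]
      by (auto intro: rev_finite_subset)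
  qed (use assms in \<open>auto simp: part_count_def\<close>)
  also have "\<dots> = (\<Sum>B\<in>Pow A. (if Suc (card B) \<in> S then 1 else 0) * part_count S (A - B) k)"
    using assms(1) by (intro sum.mono_neutral_cong_left) auto
  finally show ?thesis .
qed

lemma part_count_egf:
  fixes A :: "'a set"
  assumes "0 \<notin> S" "finite A"
  shows "of_nat (part_count S A k) / fact (card A)
    = fps_nth (SETk k (egf (\<lambda>s. if s \<in> S then 1 else 0))) (card A)"
proof (rule block_recurrence_egf[where f = "part_count S"])
  show "part_count S ({} :: 'a set) k = (if k = 0 then 1 else 0)" for k
  proof -
    have "{P. partition_on ({} :: 'a set) P \<and> (\<forall>b\<in>P. card b \<in> S) \<and> card P = k}
        = (if k = 0 then {{}} else {})"
      by (auto simp: partition_on_empty)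
    then show ?thesis by (simp add: part_count_def)
  qed
  show "part_count S (insert a A) 0 = 0" if "finite A" for A and a :: 'a
  proof -
    \<comment> \<open>Besides \<open>P\<close> being nonempty its finiteness is used, since
      \<open>card\<close> returns 0 on infinite sets.\<close>
    have "card P \<noteq> 0" if "partition_on (insert a A) P" for P
      using finite_elements[OF _ that] that \<open>finite A\<close> by (auto simp: partition_on_def)
    then have "{P. partition_on (insert a A) P \<and> (\<forall>b\<in>P. card b \<in> S) \<and> card P = 0} = {}"
      by blast
    then show ?thesis unfolding part_count_def by (simp only: card.empty)
  qed
qed (use assms part_count_insert in auto)


section \<open>Permutations\<close>

text \<open>\<open>cyclic_on\<close> leaves values outside \<open>C\<close> open;
  \<open>permutes\<close> fixes them to the identity, so each cyclic arrangement is counted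
  once.\<close>

definition cyclic_perms :: "'a set \<Rightarrow> ('a \<Rightarrow> 'a) set" where
  "cyclic_perms C = {q. q permutes C \<and> cyclic_on q C}"

definition perm_count :: "nat set \<Rightarrow> 'a set \<Rightarrow> nat \<Rightarrow> nat" where
  "perm_count S A k =
    card {p. p permutes A \<and> (\<forall>c\<in>perm_cycles p A. card c \<in> S) \<and> card (perm_cycles p A) = k}"

section \<open>Splitting a permutation at the cycle of a point\<close>

lemma finite_cyclic_perms: "finite C \<Longrightarrow> finite (cyclic_perms C)"
  unfolding cyclic_perms_def by (rule finite_subset[OF _ finite_permutations]) auto

text \<open>\<open>q\<close> and \<open>r\<close> move points of disjoint sets only, so every cycle
  of the composition comes from one factor. The last claim ensures that the number of cycles grows
  by exactly one.\<close>

lemma perm_cycles_compose_cyclic: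
  assumes "finite A" "a \<notin> A" "B \<subseteq> A" "q \<in> cyclic_perms (insert a B)" "r permutes (A - B)"
  shows "orbit (q \<circ> r) a = insert a B"
    and "perm_cycles (q \<circ> r) (insert a A) = insert (insert a B) (perm_cycles r (A - B))"
    and "insert a B \<notin> perm_cycles r (A - B)"
proof -
  have q: "q permutes insert a B" "cyclic_on q (insert a B)"
    using assms(4) by (auto simp: cyclic_perms_def)
  have "cyclic_on (q \<circ> r) (insert a B)"
    using assms q by (intro permutes_comp_preserves_cyclic1[where A = "insert a B"]) auto
  then have B: "orbit (q \<circ> r) x = insert a B" if "x \<in> insert a B" for x
    using orbit_cyclic_eq3 that by metis
  then show "orbit (q \<circ> r) a = insert a B" by simp
  have r: "orbit (q \<circ> r) x = orbit r x" if x: "x \<in> A - B" for x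
  proof -
    have "cyclic_on r (orbit r x)"
      using assms(1,5) by (intro cyclic_on_orbit[of r "A - B"]) auto
    moreover have "orbit r x \<subseteq> A - B" using assms(5) x by (rule permutes_orbit_subset)
    ultimately have "cyclic_on (q \<circ> r) (orbit r x)"
      using assms q by (intro permutes_comp_preserves_cyclic2[where B = "A - B"]) auto
    \<comment> \<open>\<open>orbit\<close> starts at \<open>r x\<close>, so membership of
      \<open>x\<close> itself requires that the iterates return, as they do for a permutation of a
      finite set.\<close>
    moreover have "x \<in> orbit r x"
      using assms by (intro permutation_self_in_orbit permutes_imp_permutation[of "A - B"]) auto
    ultimately show ?thesis by (rule orbit_cyclic_eq3)
  qed
  have "insert a A = insert a B \<union> (A - B)" using assms(3) by blast
  then show "perm_cycles (q \<circ> r) (insert a A) = insert (insert a B) (perm_cycles r (A - B))"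
    unfolding perm_cycles_def using B r by (simp only: image_Un) auto
  show "insert a B \<notin> perm_cycles r (A - B)"
    using permutes_orbit_subset[OF assms(5)] assms(2) by (auto simp: perm_cycles_def)
qed

text \<open>The cycle of \<open>a\<close> takes the role of the block of \<open>a\<close>. The
  inverse restricts a permutation to that cycle and to its complement, extending both pieces by the
  identity.\<close>

lemma bij_betw_perm_insert:
  assumes "finite A" "a \<notin> A"
  shows "bij_betw (\<lambda>(B, q, r). q \<circ> r)
    (SIGMA B:Pow A. cyclic_perms (insert a B) \<times> {r. r permutes (A - B)})
    {p. p permutes (insert a A)}"
    (is "bij_betw ?f ?T ?X")
proof (rule bij_betw_byWitness[where f' = "\<lambda>p. (orbit p a - {a}, perm_restrict p (orbit p a),
    perm_restrict p (insert a A - orbit p a))"])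
  let ?g = "\<lambda>p. (orbit p a - {a}, perm_restrict p (orbit p a),
    perm_restrict p (insert a A - orbit p a))"
  show "\<forall>t\<in>?T. ?g (?f t) = t"
  proof
    fix t assume "t \<in> ?T"
    then obtain B q r where t_eq: "t = (B, q, r)"
      and t: "B \<subseteq> A" "q \<in> cyclic_perms (insert a B)" "r permutes (A - B)" by auto
    have orb: "orbit (q \<circ> r) a = insert a B"
      using perm_cycles_compose_cyclic(1)[OF assms t] .
    have q: "q permutes insert a B" using t by (simp add: cyclic_perms_def)
    have rq: "q x = x" if "x \<notin> insert a B" for x using q that by (simp add: permutes_not_in)
    have rr: "r x = x" if "x \<notin> A - B" for x using t that by (simp add: permutes_not_in)
    \<comment> \<open>\<open>r\<close> keeps \<open>A - B\<close> invariant, so \<open>q\<close>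
      leaves \<open>r x\<close> unmoved for \<open>x\<close> in that set.\<close>
    have rin: "r x \<in> A - B \<longleftrightarrow> x \<in> A - B" for x using permutes_in_image[OF t(3)] .
    have 1: "perm_restrict (q \<circ> r) (insert a B) = q"
    proof
      fix x show "perm_restrict (q \<circ> r) (insert a B) x = q x"
        using rr[of x] rq[of x] assms(2) by (auto simp: perm_restrict_def)
    qed
    have 2: "perm_restrict (q \<circ> r) (insert a A - insert a B) = r"
    proof
      fix x show "perm_restrict (q \<circ> r) (insert a A - insert a B) x = r x"
        using rr[of x] rq[of "r x"] rin[of x] assms(2) by (auto simp: perm_restrict_def)
    qed
    have "insert a B - {a} = B" using t assms(2) by blast
    then show "?g (?f t) = t"
      using orb 1 2 by (simp add: t_eq)
  qed
  have main: "?f (?g p) = p \<and> ?g p \<in> ?T" if p: "p permutes insert a A" for p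
  proof -
    have perm: "permutation p" using p assms(1) by (auto simp: permutation_permutes)
    have a: "a \<in> orbit p a" using perm by (rule permutation_self_in_orbit)
    have cyc: "cyclic_on p (orbit p a)" using perm by (rule cyclic_on_orbit')
    have sub: "orbit p a \<subseteq> insert a A" using p by (intro permutes_orbit_subset) auto
    have r: "perm_restrict p (insert a A - orbit p a) permutes (insert a A - orbit p a)"
      by (rule perm_restrict_diff_cyclic[OF p cyc])
    have q: "perm_restrict p (orbit p a) permutes orbit p a"
    proof (rule inj_imp_permutes)
      show "inj_on (perm_restrict p (orbit p a)) (orbit p a)"
        using permutes_inj[OF p] by (auto simp: inj_on_def perm_restrict_def)
      show "finite (orbit p a)" using sub assms(1) by (auto intro: finite_subset)
    qed (use cyc cyclic_on_inI in \<open>auto simp: perm_restrict_def\<close>)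
    have comp: "perm_restrict p (orbit p a) \<circ> perm_restrict p (insert a A - orbit p a) = p"
    proof -
      have "perm_restrict p (orbit p a) \<circ> perm_restrict p (insert a A - orbit p a)
          = perm_restrict p (orbit p a \<union> (insert a A - orbit p a))"
        by (rule perm_restrict_union[OF q r]) auto
      also have "orbit p a \<union> (insert a A - orbit p a) = insert a A" using sub by blast
      finally show ?thesis unfolding perm_restrict_id[OF p] .
    qed
    have "insert a (orbit p a - {a}) = orbit p a" "A - (orbit p a - {a}) = insert a A - orbit p a"
      using a assms(2) by auto
    then show ?thesis
      using comp q r cyc sub by (auto simp: cyclic_perms_def cyclic_on_perm_restrict)
  qed
  show "\<forall>p\<in>?X. ?f (?g p) = p" "?g ` ?X \<subseteq> ?T" using main by blast+
  show "?f ` ?T \<subseteq> ?X"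
  proof
    fix p assume "p \<in> ?f ` ?T"
    then obtain B q r where p: "p = q \<circ> r"
      and "B \<subseteq> A" "q \<in> cyclic_perms (insert a B)" "r permutes (A - B)" by auto
    then have "q permutes insert a A" "r permutes insert a A"
      by (auto simp: cyclic_perms_def intro: permutes_subset)
    then show "p \<in> ?X" by (simp add: p permutes_compose)
  qed
qed

text \<open>The number of cyclic permutations is extracted from the decomposition above: the \<open>(n + 1)!\<close>
  permutations of \<open>insert a A\<close> split according to the cycle of \<open>a\<close>, and by induction each of the
  sizes \<open>j < n\<close> of that cycle without \<open>a\<close> accounts for \<open>(n choose j) j! (n - j)! = n!\<close> of them.\<close>

lemma card_cyclic_perms_insert:
  assumes "finite A" "a \<notin> A"
  shows "card (cyclic_perms (insert a A)) = fact (card A)"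
  using assms
proof (induction A rule: finite_psubset_induct)
  case (psubset A)
  let ?n = "card A"
  note fin = \<open>finite A\<close>
  let ?c = "\<lambda>B. card (cyclic_perms (insert a B)) * fact (card (A - B))"
  have "fact (Suc ?n) = card {p. p permutes insert a A}"
    using card_permutations[OF refl, of "insert a A"] psubset.prems fin by simp
  also have "\<dots> = card (SIGMA B:Pow A. cyclic_perms (insert a B) \<times> {r. r permutes (A - B)})"
    using bij_betw_same_card[OF bij_betw_perm_insert[OF fin psubset.prems]] by simp
  also have "\<dots> = (\<Sum>B\<in>Pow A. ?c B)"
  proof (subst card_SigmaI)
    show "\<forall>B\<in>Pow A. finite (cyclic_perms (insert a B) \<times> {r. r permutes (A - B)})"
      using fin by (auto intro!: finite_cartesian_product finite_cyclic_perms finite_permutations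
          intro: finite_subset)
    show "(\<Sum>B\<in>Pow A. card (cyclic_perms (insert a B) \<times> {r. r permutes (A - B)})) = (\<Sum>B\<in>Pow A. ?c B)"
      using fin by (intro sum.cong) (auto simp: card_cartesian_product card_permutations)
  qed (use fin in auto)
  \<comment> \<open>The term \<open>B = A\<close> is the unknown number, with factor
    \<open>fact 0 = 1\<close>; all other \<open>B\<close> are proper subsets, where the induction
    hypothesis applies.\<close>
  also have "\<dots> = card (cyclic_perms (insert a A)) + (\<Sum>B\<in>Pow A - {A}. ?c B)"
    using fin by (subst sum.remove[of _ A]) auto
  also have "(\<Sum>B\<in>Pow A - {A}. ?c B) = (\<Sum>B\<in>Pow A - {A}. fact (card B) * fact (?n - card B))"
  proof (rule sum.cong)
    fix B assume B: "B \<in> Pow A - {A}"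
    then have "card (cyclic_perms (insert a B)) = fact (card B)"
      using psubset by (intro psubset.IH) auto
    moreover have "card (A - B) = ?n - card B"
      using B fin by (intro card_Diff_subset) (auto intro: finite_subset)
    ultimately show "?c B = fact (card B) * fact (?n - card B)" by simp
  qed simp
  finally have 1: "fact (Suc ?n) = card (cyclic_perms (insert a A))
      + (\<Sum>B\<in>Pow A - {A}. fact (card B) * fact (?n - card B))" .
  \<comment> \<open>Putting \<open>fact ?n\<close> in place of the unknown term gives the same total
    \<open>fact (Suc ?n)\<close>, so the two agree.\<close>
  have "fact ?n + (\<Sum>B\<in>Pow A - {A}. fact (card B) * fact (?n - card B))
      = (\<Sum>B\<in>Pow A. fact (card B) * fact (?n - card B))"
    using fin by (subst sum.remove[of "Pow A" A]) auto
  also have "\<dots> = (\<Sum>j\<le>?n. (?n choose j) * (fact j * fact (?n - j)))"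
    using sum_Pow_card[OF fin, of "\<lambda>j. fact j * fact (?n - j) :: nat"] by simp
  also have "\<dots> = (\<Sum>j\<le>?n. fact ?n)"
    by (intro sum.cong) (auto simp: binomial_fact_lemma mult.commute[of "_ choose _"])
  also have "\<dots> = fact (Suc ?n)" by simp
  finally show ?case using 1 by simp
qed

text \<open>The factor \<open>fact (card B)\<close> counts the cyclic arrangements of the
  \<open>card B + 1\<close> points in the cycle of \<open>a\<close>.\<close>

lemma perm_count_insert:
  assumes "finite A" "a \<notin> A"
  shows "perm_count S (insert a A) (Suc k)
    = (\<Sum>B\<in>Pow A. (if Suc (card B) \<in> S then fact (card B) else 0) * perm_count S (A - B) k)"
proof -
  let ?Q = "\<lambda>p. (\<forall>c\<in>perm_cycles p (insert a A). card c \<in> S) \<and> card (perm_cycles p (insert a A)) = Suc k"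
  let ?N = "\<lambda>B. {r. r permutes (A - B) \<and> (\<forall>c\<in>perm_cycles r (A - B). card c \<in> S)
      \<and> card (perm_cycles r (A - B)) = k}"
  let ?T = "SIGMA B:Pow A. cyclic_perms (insert a B) \<times> {r. r permutes (A - B)}"
  have "perm_count S (insert a A) (Suc k) = card {p \<in> {p. p permutes insert a A}. ?Q p}"
    by (simp add: perm_count_def)
  also have "\<dots> = card {t \<in> ?T. ?Q ((\<lambda>(B, q, r). q \<circ> r) t)}"
    by (rule bij_betw_Collect_card[OF bij_betw_perm_insert[OF assms]])
  also have "{t \<in> ?T. ?Q ((\<lambda>(B, q, r). q \<circ> r) t)}
      = (SIGMA B:{B \<in> Pow A. Suc (card B) \<in> S}. cyclic_perms (insert a B) \<times> ?N B)"
  proof -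
    \<comment> \<open>The condition depends on \<open>B\<close> and \<open>r\<close> but not on
      \<open>q\<close>; hence \<open>q\<close> ranges freely and the fibre over \<open>B\<close> is
      a product.\<close>
    have *: "?Q (q \<circ> r) \<longleftrightarrow> Suc (card B) \<in> S \<and> r \<in> ?N B"
      if "B \<subseteq> A" "q \<in> cyclic_perms (insert a B)" "r permutes (A - B)" for B q r
    proof -
      have "finite (perm_cycles r (A - B))" using assms by (simp add: perm_cycles_def)
      moreover have "card (insert a B) = Suc (card B)"
        using assms that finite_subset by (subst card_insert_disjoint) auto
      ultimately show ?thesis
        using perm_cycles_compose_cyclic(2,3)[OF assms that] that(3) by simp
    qed
    show ?thesis
    proof (rule set_eqI)
      fix t :: "'a set \<times> ('a \<Rightarrow> 'a) \<times> ('a \<Rightarrow> 'a)"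
      obtain B q r where t: "t = (B, q, r)" by (cases t)
      show "t \<in> {t \<in> ?T. ?Q ((\<lambda>(B, q, r). q \<circ> r) t)} \<longleftrightarrow>
          t \<in> (SIGMA B:{B \<in> Pow A. Suc (card B) \<in> S}. cyclic_perms (insert a B) \<times> ?N B)"
        using *[of B q r] by (simp only: t mem_Collect_eq mem_Sigma_iff prod.case Pow_iff) blast
    qed
  qed
  also have "card \<dots> = (\<Sum>B\<in>{B \<in> Pow A. Suc (card B) \<in> S}. fact (card B) * perm_count S (A - B) k)"
  proof (subst card_SigmaI)
    show "\<forall>B\<in>{B \<in> Pow A. Suc (card B) \<in> S}. finite (cyclic_perms (insert a B) \<times> ?N B)"
    proof
      fix B assume "B \<in> {B \<in> Pow A. Suc (card B) \<in> S}"
      then have "finite B" using assms finite_subset by auto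
      moreover have "finite (?N B)"
        by (rule finite_subset[OF _ finite_permutations[of "A - B"]]) (use assms in auto)
      ultimately show "finite (cyclic_perms (insert a B) \<times> ?N B)"
        by (simp add: finite_cyclic_perms)
    qed
    show "(\<Sum>B\<in>{B \<in> Pow A. Suc (card B) \<in> S}. card (cyclic_perms (insert a B) \<times> ?N B))
        = (\<Sum>B\<in>{B \<in> Pow A. Suc (card B) \<in> S}. fact (card B) * perm_count S (A - B) k)"
    proof (rule sum.cong)
      fix B assume "B \<in> {B \<in> Pow A. Suc (card B) \<in> S}"
      then have "card (cyclic_perms (insert a B)) = fact (card B)"
        using assms finite_subset by (intro card_cyclic_perms_insert) auto
      then show "card (cyclic_perms (insert a B) \<times> ?N B) = fact (card B) * perm_count S (A - B) k"
        by (simp add: card_cartesian_product perm_count_def)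
    qed simp
  qed (use assms in auto)
  also have "\<dots> = (\<Sum>B\<in>Pow A. (if Suc (card B) \<in> S then fact (card B) else 0) * perm_count S (A - B) k)"
    using assms(1) by (intro sum.mono_neutral_cong_left) auto
  finally show ?thesis .
qed

lemma perm_count_egf:
  fixes A :: "'a set"
  assumes "0 \<notin> S" "finite A"
  shows "of_nat (perm_count S A k) / fact (card A)
    = fps_nth (SETk k (egf (\<lambda>s. if s \<in> S then fact (s - 1) else 0))) (card A)"
proof (rule block_recurrence_egf[where f = "perm_count S"])
  show "perm_count S ({} :: 'a set) k = (if k = 0 then 1 else 0)" for k
  proof -
    have "{p. p permutes ({} :: 'a set) \<and> (\<forall>c\<in>perm_cycles p {}. card c \<in> S)
        \<and> card (perm_cycles p {}) = k} = (if k = 0 then {id} else {})"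
      by (auto simp: perm_cycles_def)
    then show ?thesis by (simp add: perm_count_def)
  qed
  show "perm_count S (insert a A) 0 = 0" if "finite A" for A and a :: 'a
    using that by (simp add: perm_count_def perm_cycles_def)
  show "perm_count S (insert a A) (Suc k) = (\<Sum>B\<in>Pow A.
      (if Suc (card B) \<in> S then fact (Suc (card B) - 1) else 0) * perm_count S (A - B) k)"
    if "finite A" "a \<notin> A" for A and a :: 'a and k
    using perm_count_insert[OF that, of S k] by (simp only: diff_Suc_1)
qed (use assms in auto)


section \<open>Generating functions\<close>

text \<open>For positive \<open>s\<close>, \<open>(s - 1)! / s!\<close> is \<open>1 / s\<close>.
  Positivity excludes \<open>s = 0\<close>, where the left coefficient would be
  \<open>1 / 0 = 0\<close> but the right one 1.\<close>

lemma infsum_CYCk_atom: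
  assumes "\<forall>s\<in>S. s > 0"
  shows "(\<Sum>\<^sub>\<infinity>s\<in>S. CYCk s atom) = egf (\<lambda>s. if s \<in> S then fact (s - 1) else 0)"
proof -
  have "(\<Sum>\<^sub>\<infinity>s\<in>S. CYCk s atom) = Abs_fps (\<lambda>n. if n \<in> S then 1 / of_nat n else 0)"
    unfolding CYCk_def atom_def by (rule infsumI[OF has_sum_fps_monomials])
  also have "\<dots> = egf (\<lambda>s. if s \<in> S then fact (s - 1) else 0)"
    using assms by (auto simp: egf_def fps_eq_iff fact_reduce)
  finally show ?thesis .
qed

lemma infsum_SETk_atom:
  "(\<Sum>\<^sub>\<infinity>s\<in>S. SETk s atom) = egf (\<lambda>s. if s \<in> S then 1 else 0)"
proof -
  have "(\<Sum>\<^sub>\<infinity>s\<in>S. SETk s atom) = Abs_fps (\<lambda>n. if n \<in> S then 1 / fact n else 0)"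
    unfolding SETk_def atom_def by (rule infsumI[OF has_sum_fps_monomials])
  also have "\<dots> = egf (\<lambda>s. if s \<in> S then 1 else 0)"
    by (auto simp: egf_def fps_eq_iff)
  finally show ?thesis .
qed

section \<open>Identities for a fixed number of cycles or blocks\<close>

lemma egf_stirling1_S:
  assumes "0 \<notin> S"
  shows "egf (\<lambda>n. stirling1_S S n k) = SETk k (egf (\<lambda>s. if s \<in> S then fact (s - 1) else 0))"
proof (rule fps_ext)
  fix n
  have "stirling1_S S n k = perm_count S {..<n} k"
    by (simp add: stirling1_S_def perm_count_def perms_S_def conj_assoc)
  then show "fps_nth (egf (\<lambda>n. stirling1_S S n k)) n
      = fps_nth (SETk k (egf (\<lambda>s. if s \<in> S then fact (s - 1) else 0))) n"
    using perm_count_egf[OF assms, of "{..<n}" k] by (simp add: egf_nth)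
qed

lemma egf_stirling2_S:
  assumes "0 \<notin> S"
  shows "egf (\<lambda>n. stirling2_S S n k) = SETk k (egf (\<lambda>s. if s \<in> S then 1 else 0))"
proof (rule fps_ext)
  fix n
  have "stirling2_S S n k = part_count S {..<n} k"
    by (simp add: stirling2_S_def part_count_def parts_S_def)
  then show "fps_nth (egf (\<lambda>n. stirling2_S S n k)) n
      = fps_nth (SETk k (egf (\<lambda>s. if s \<in> S then 1 else 0))) n"
    using part_count_egf[OF assms, of "{..<n}" k] by (simp add: egf_nth)
qed

section \<open>Summation over the number of cycles or blocks\<close>

lemma card_eq_sum_card_fibres:
  fixes n :: nat
  assumes "finite X" "\<And>x. x \<in> X \<Longrightarrow> g x \<le> n"
  shows "card X = (\<Sum>k\<le>n. card {x \<in> X. g x = k})"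
  using sum.group[of X "{..n}" g "\<lambda>_. 1 :: nat"] assms by (simp add: image_subset_iff)

text \<open>Every cycle is the orbit of some point, so there are at most \<open>n\<close>
  cycles.\<close>

lemma A_S_eq_sum: "A_S S n = (\<Sum>k\<le>n. stirling1_S S n k)"
  unfolding A_S_def stirling1_S_def
proof (rule card_eq_sum_card_fibres)
  show "finite (perms_S S n)"
    unfolding perms_S_def by (rule finite_subset[OF _ finite_permutations[of "{..<n}"]]) auto
  show "card (perm_cycles p {..<n}) \<le> n" for p
    unfolding perm_cycles_def using card_image_le[of "{..<n}" "orbit p"] by simp
qed

text \<open>Each block is finite and nonempty, so it contributes at least 1 to the sum of block
  sizes, which is \<open>card A\<close>.\<close>

lemma card_partition_on_le:
  assumes "finite A" "partition_on A P"
  shows "card P \<le> card A"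
proof -
  have fin: "finite P" using assms by (rule finite_elements)
  have "card b \<ge> 1" if "b \<in> P" for b
    using assms that by (auto simp: partition_on_def Suc_le_eq card_gt_0_iff dest: finite_subset[rotated, OF _ Union_upper])
  then have "card P \<le> (\<Sum>b\<in>P. card b)"
    using sum_mono[of P "\<lambda>_. 1" card] by simp
  also have "\<dots> = card A" by (rule product_partition[OF assms(2), symmetric])
      (use assms in \<open>auto simp: partition_on_def intro: finite_subset[OF Union_upper]\<close>)
  finally show ?thesis .
qed

lemma B_S_eq_sum: "B_S S n = (\<Sum>k\<le>n. stirling2_S S n k)"
  unfolding B_S_def stirling2_S_def
proof (rule card_eq_sum_card_fibres)
  show "finite (parts_S S n)"
    unfolding parts_S_def
    by (rule finite_subset[OF _ finitely_many_partition_on[of "{..<n}"]]) auto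
  show "card P \<le> n" if "P \<in> parts_S S n" for P
    using card_partition_on_le[of "{..<n}" P] that by (simp add: parts_S_def)
qed

text \<open>The bound \<open>k \<le> n\<close> on the number of components matches the truncation of
  the exponential in degree \<open>n\<close>, so the identities for fixed \<open>k\<close> add
  up.\<close>

lemma egf_eq_SET:
  assumes "\<And>n. a n = (\<Sum>k\<le>n. b n k)" and "\<And>k. egf (\<lambda>n. b n k) = SETk k F"
    and "fps_nth F 0 = 0"
  shows "egf a = SET F"
proof (rule fps_ext)
  fix n
  have "fps_nth (egf a) n = (\<Sum>k\<le>n. fps_nth (egf (\<lambda>n. b n k)) n)"
    by (simp add: egf_nth assms(1) sum_divide_distrib)
  then show "fps_nth (egf a) n = fps_nth (SET F) n"
    by (simp add: assms(2) SET_nth[OF assms(3)])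
qed


theorem theorem1:
  fixes S :: "nat set" and k :: nat
  assumes "S \<noteq> {}" and "\<forall>s\<in>S. s > 0"
  shows
    "(egf (\<lambda>n. stirling1_S S n k) = SETk k (\<Sum>\<^sub>\<infinity>s\<in>S. CYCk s atom) \<and>
      SETk k (\<Sum>\<^sub>\<infinity>s\<in>S. CYCk s atom)
        = fps_const (1 / fact k) * (\<Sum>\<^sub>\<infinity>s\<in>S. fps_const (1 / of_nat s) * fps_X ^ s) ^ k) \<and>
     (egf (\<lambda>n. stirling2_S S n k) = SETk k (\<Sum>\<^sub>\<infinity>s\<in>S. SETk s atom) \<and>
      SETk k (\<Sum>\<^sub>\<infinity>s\<in>S. SETk s atom)
        = fps_const (1 / fact k) * (\<Sum>\<^sub>\<infinity>s\<in>S. fps_const (1 / fact s) * fps_X ^ s) ^ k) \<and>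
     (egf (A_S S) = SET (\<Sum>\<^sub>\<infinity>s\<in>S. CYCk s atom) \<and>
      SET (\<Sum>\<^sub>\<infinity>s\<in>S. CYCk s atom)
        = fps_exp 1 oo (\<Sum>\<^sub>\<infinity>s\<in>S. fps_const (1 / of_nat s) * fps_X ^ s)) \<and>
     (egf (B_S S) = SET (\<Sum>\<^sub>\<infinity>s\<in>S. SETk s atom) \<and>
      SET (\<Sum>\<^sub>\<infinity>s\<in>S. SETk s atom)
        = fps_exp 1 oo (\<Sum>\<^sub>\<infinity>s\<in>S. fps_const (1 / fact s) * fps_X ^ s))"
proof -
  have 0: "0 \<notin> S" using assms(2) by blast
  have cyc: "CYCk s atom = fps_const (1 / of_nat s) * fps_X ^ s"
    and set: "SETk s atom = fps_const (1 / fact s) * fps_X ^ s" for s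
    by (simp_all add: CYCk_def SETk_def atom_def)
  \<comment> \<open>The constant term vanishes because 0 is outside \<open>S\<close>.\<close>
  have A: "egf (A_S S) = SET (egf (\<lambda>s. if s \<in> S then fact (s - 1) else 0))"
    using 0 by (intro egf_eq_SET[OF A_S_eq_sum egf_stirling1_S[OF 0]]) (simp add: egf_nth)
  have B: "egf (B_S S) = SET (egf (\<lambda>s. if s \<in> S then 1 else 0))"
    using 0 by (intro egf_eq_SET[OF B_S_eq_sum egf_stirling2_S[OF 0]]) (simp add: egf_nth)
  show ?thesis
  proof (intro conjI)
    show "egf (\<lambda>n. stirling1_S S n k) = SETk k (\<Sum>\<^sub>\<infinity>s\<in>S. CYCk s atom)"
      unfolding infsum_CYCk_atom[OF assms(2)] by (rule egf_stirling1_S[OF 0])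
    show "egf (\<lambda>n. stirling2_S S n k) = SETk k (\<Sum>\<^sub>\<infinity>s\<in>S. SETk s atom)"
      unfolding infsum_SETk_atom by (rule egf_stirling2_S[OF 0])
    show "egf (A_S S) = SET (\<Sum>\<^sub>\<infinity>s\<in>S. CYCk s atom)"
      unfolding infsum_CYCk_atom[OF assms(2)] by (rule A)
    show "egf (B_S S) = SET (\<Sum>\<^sub>\<infinity>s\<in>S. SETk s atom)"
      unfolding infsum_SETk_atom by (rule B)
  \<comment> \<open>The remaining equalities unfold the constructions. Instantiating
    \<open>SETk_def\<close> at \<open>k\<close> reaches only the outer one; the inner sets of atoms
    are rewritten by \<open>set\<close>.\<close>
  qed (simp_all only: cyc set SET_def SETk_def[of k])
qed

end
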